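(* Let $f:\mathcal{C}(1)\to\mathcal{C}(2)$ be a morphism of regular exact couples of $R$-modules (with bidegrees $\mathbf{a},\mathbf{b},\mathbf{c}$) such that the following hold for a given $n\in\mathbb{Z}$: (i) For all $\mathbf{x}$ with $\det[\mathbf{a}\ \mathbf{x}]=n$, the induced map $f^\infty:E^\infty_{\mathbf{x}+\mathbf{b}}(1)\to E^\infty_{\mathbf{x}+\mathbf{b}}(2)$ is a monomorphism. (ii) $f$ induces a monomorphism $\lim_r F_{\mathbf{x}(n)+r\mathbf{a}}(1)\to\lim_rF_{\mathbf{x}(n)+r\mathbf{a}}(2)$. Then $f$ induces a monomorphism $L_nf:L_n(1)\to L_n(2)$.
   Context: $R$ is a unital ring. A $(\mathbb{Z}\times\mathbb{Z})$-bigraded exact couple $(E,D,i,j,k)$ with bidegrees $\mathbf{a},\mathbf{b},\mathbf{c}\in\mathbb{Z}\times\mathbb{Z}$ consists of families of $R$-modules $D_{\mathbf{x}},E_{\mathbf{x}}$ ($\mathbf{x}\in\mathbb{Z}\times\mathbb{Z}$) and $R$-linear maps $i_{\mathbf{x}}:D_{\mathbf{x}}\to D_{\mathbf{x}+\mathbf{a}}$, $j_{\mathbf{x}}:D_{\mathbf{x}}\to E_{\mathbf{x}+\mathbf{b}}$, $k_{\mathbf{x}}:E_{\mathbf{x}}\to D_{\mathbf{x}+\mathbf{c}}$ such that $D_{\mathbf{x}-\mathbf{a}}\xrightarrow{i}D_{\mathbf{x}}\xrightarrow{j}E_{\mathbf{x}+\mathbf{b}}\xrightarrow{k}D_{\mathbf{x}+\mathbf{b}+\mathbf{c}}\xrightarrow{i}D_{\mathbf{x}+\mathbf{a}+\mathbf{b}+\mathbf{c}}$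 is exact for all $\mathbf{x}$. It is regular if $\sigma:=\det[\mathbf{a}\ (\mathbf{b}+\mathbf{c})]\in\{1,-1\}$. A morphism of exact couples with equal bidegrees is a pair of families $D_{\mathbf{x}}(1)\to D_{\mathbf{x}}(2)$, $E_{\mathbf{x}}(1)\to E_{\mathbf{x}}(2)$ of $R$-linear maps commuting with $i,j,k$. With $i^r_{\mathbf{x}}:D_{\mathbf{x}}\to D_{\mathbf{x}+r\mathbf{a}}$ the $r$-fold composite of $i$: $Z^r_{\mathbf{x}+\mathbf{b}}=k^{-1}(\operatorname{im}\,i^r_{\mathbf{x}+\mathbf{b}+\mathbf{c}-r\mathbf{a}})$, $B^r_{\mathbf{x}+\mathbf{b}}=j(\ker i^r_{\mathbf{x}})$, $E^\infty_{\mathbf{x}+\mathbf{b}}=\bigcap_rZ^r_{\mathbf{x}+\mathbf{b}}/\bigcup_rB^r_{\mathbf{x}+\mathbf{b}}$. Put $\mathbf{x}(n)=\sigma n(\mathbf{b}+\mathbf{c})$; then $\det[\mathbf{a}\ \mathbf{x}]=n$ iff $\mathbf{x}=\mathbf{x}(n)+r\mathbf{a}$ for some $r\in\mathbb{Z}$. The colimit abutment $L_n$ is the colimit of the diagram $r\mapsto D_{\mathbf{x}(n)+r\mathbf{a}}$ ($r\in\mathbb{Z}$, structure maps $i$), filtered by $F_{\mathbf{x}}=\operatorname{im}(D_{\mathbf{x}}\to L_n)$ for $\det[\mathbf{a}\ \mathbf{x}]=n$; $\lim_rF_{\mathbf{x}(n)+r\mathbf{a}}=\bigcap_rF_{\mathbf{x}(n)+r\mathbf{a}}$.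 Morphisms of exact couples induce maps on all these objects. *)

theory Defs
  imports "HOL-Algebra.QuotRing" "HOL-Algebra.Module" "HOL-Library.Product_Plus"
begin

section \<open>Left modules over a unital ring\<close>

text \<open>
  The library locale \<^locale>\<open>module\<close> requires the ring of scalars to be commutative. The
  following locale has the same axioms over an arbitrary unital ring (\<^locale>\<open>ring\<close> includes
  a unit). The fields \<^const>\<open>monoid.mult\<close> and \<^const>\<open>monoid.one\<close> of the record type of
  modules carry no information about the module and are never used below.
\<close>

locale left_module = R?: ring R + M?: abelian_group M
  for R :: "('r, 'q) ring_scheme" (structure) and M :: "('r, 'u) module" (structure) +
  assumes smult_closed:
      "\<lbrakk>s \<in> carrier R; x \<in> carrier M\<rbrakk> \<Longrightarrow> s \<odot>\<^bsub>M\<^esub> x \<in> carrier M"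
    and smult_l_distr:
      "\<lbrakk>s \<in> carrier R; t \<in> carrier R; x \<in> carrier M\<rbrakk> \<Longrightarrow>
        (s \<oplus>\<^bsub>R\<^esub> t) \<odot>\<^bsub>M\<^esub> x = s \<odot>\<^bsub>M\<^esub> x \<oplus>\<^bsub>M\<^esub> t \<odot>\<^bsub>M\<^esub> x"
    and smult_r_distr:
      "\<lbrakk>s \<in> carrier R; x \<in> carrier M; y \<in> carrier M\<rbrakk> \<Longrightarrow>
        s \<odot>\<^bsub>M\<^esub> (x \<oplus>\<^bsub>M\<^esub> y) = s \<odot>\<^bsub>M\<^esub> x \<oplus>\<^bsub>M\<^esub> s \<odot>\<^bsub>M\<^esub> y"
    and smult_assoc:
      "\<lbrakk>s \<in> carrier R; t \<in> carrier R; x \<in> carrier M\<rbrakk> \<Longrightarrow>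
        (s \<otimes>\<^bsub>R\<^esub> t) \<odot>\<^bsub>M\<^esub> x = s \<odot>\<^bsub>M\<^esub> (t \<odot>\<^bsub>M\<^esub> x)"
    and smult_one:
      "x \<in> carrier M \<Longrightarrow> \<one>\<^bsub>R\<^esub> \<odot>\<^bsub>M\<^esub> x = x"

definition lin_maps ::
  "('r, 'q) ring_scheme \<Rightarrow> ('r, 'u) module \<Rightarrow> ('r, 'v) module \<Rightarrow> ('u \<Rightarrow> 'v) set" where
  "lin_maps R M N = {h \<in> carrier M \<rightarrow> carrier N.
     (\<forall>x\<in>carrier M. \<forall>y\<in>carrier M. h (x \<oplus>\<^bsub>M\<^esub> y) = h x \<oplus>\<^bsub>N\<^esub> h y) \<and>
     (\<forall>s\<in>carrier R. \<forall>x\<in>carrier M. h (s \<odot>\<^bsub>M\<^esub> x) = s \<odot>\<^bsub>N\<^esub> h x)}"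

definition monomorphism ::
  "('r, 'q) ring_scheme \<Rightarrow> ('r, 'u) module \<Rightarrow> ('r, 'v) module \<Rightarrow> ('u \<Rightarrow> 'v) \<Rightarrow> bool" where
  "monomorphism R M N h \<longleftrightarrow> h \<in> lin_maps R M N \<and> inj_on h (carrier M)"

text \<open>
  The quotient \<open>Z / B\<close> of submodules \<open>B \<subseteq> Z\<close> of \<open>M\<close>, and the map \<open>Z / B \<rightarrow> Z' / B'\<close> of such
  quotients, sending the coset of \<open>z\<close> to the coset of \<open>h z\<close>, that is induced by a linear map \<open>h\<close>
  with \<open>h ` Z \<subseteq> Z'\<close> and \<open>h ` B \<subseteq> B'\<close> (for \<open>B'\<close> a submodule of \<open>N\<close>). As for \<^const>\<open>rcoset_mult\<close>
  in the library, operations on cosets are unions over all representatives; these unions run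
  over equal sets.
\<close>

definition subquotient ::
  "('r, 'u) module \<Rightarrow> 'u set \<Rightarrow> 'u set \<Rightarrow> ('r, 'u set) module" where
  "subquotient M Z B =
    \<lparr>carrier = (\<lambda>z. B +>\<^bsub>M\<^esub> z) ` Z, mult = undefined, one = undefined,
     zero = B, add = set_add M,
     smult = (\<lambda>s K. \<Union>x\<in>K. B +>\<^bsub>M\<^esub> (s \<odot>\<^bsub>M\<^esub> x))\<rparr>"

definition coset_map :: "('r, 'v) module \<Rightarrow> 'v set \<Rightarrow> ('u \<Rightarrow> 'v) \<Rightarrow> 'u set \<Rightarrow> 'v set" where
  "coset_map N B' h K = (\<Union>x\<in>K. B' +>\<^bsub>N\<^esub> h x)"


section \<open>Colimits of diagrams indexed by the integers\<close>

text \<open>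
  A diagram is a family \<open>M r\<close> of modules with maps \<open>\<phi> r : M r \<rightarrow> M (r + 1)\<close>. The composite of
  the \<open>k\<close> maps starting at \<open>M r\<close> is \<open>iter_map \<phi> k r\<close>.
\<close>

primrec iter_map :: "(int \<Rightarrow> 'u \<Rightarrow> 'u) \<Rightarrow> nat \<Rightarrow> int \<Rightarrow> 'u \<Rightarrow> 'u" where
  "iter_map \<phi> 0 r x = x"
| "iter_map \<phi> (Suc k) r x = \<phi> (r + int k) (iter_map \<phi> k r x)"

text \<open>
  The usual construction of a directed colimit: the disjoint union of the \<open>M r\<close>, where two
  elements are identified if they become equal at some later index.
\<close>

definition colim_rel ::
  "(int \<Rightarrow> ('r, 'u) module) \<Rightarrow> (int \<Rightarrow> 'u \<Rightarrow> 'u) \<Rightarrow> ((int \<times> 'u) \<times> (int \<times> 'u)) set" where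
  "colim_rel M \<phi> = {((r, x), (s, y)). x \<in> carrier (M r) \<and> y \<in> carrier (M s) \<and>
     (\<exists>k l. r + int k = s + int l \<and> iter_map \<phi> k r x = iter_map \<phi> l s y)}"

definition colim_in ::
  "(int \<Rightarrow> ('r, 'u) module) \<Rightarrow> (int \<Rightarrow> 'u \<Rightarrow> 'u) \<Rightarrow> int \<Rightarrow> 'u \<Rightarrow> (int \<times> 'u) set" where
  "colim_in M \<phi> r x = colim_rel M \<phi> `` {(r, x)}"

text \<open>
  Any two classes have representatives at a common index \<open>r\<close>; the sum below does not depend on
  the choice of these, so that again all sets in the unions are equal.
\<close>

definition colim ::
  "(int \<Rightarrow> ('r, 'u) module) \<Rightarrow> (int \<Rightarrow> 'u \<Rightarrow> 'u) \<Rightarrow> ('r, (int \<times> 'u) set) module" where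
  "colim M \<phi> =
    \<lparr>carrier = (SIGMA r:UNIV. carrier (M r)) // colim_rel M \<phi>,
     mult = undefined, one = undefined,
     zero = colim_in M \<phi> 0 \<zero>\<^bsub>M 0\<^esub>,
     add = (\<lambda>K L. \<Union>{colim_in M \<phi> r (x \<oplus>\<^bsub>M r\<^esub> y) |r x y. (r, x) \<in> K \<and> (r, y) \<in> L}),
     smult = (\<lambda>s K. \<Union>{colim_in M \<phi> r (s \<odot>\<^bsub>M r\<^esub> x) |r x. (r, x) \<in> K})\<rparr>"

text \<open>
  The map into the colimit of \<open>(N, \<psi>)\<close> that is induced by maps \<open>h r : M r \<rightarrow> N r\<close> commuting
  with the structure maps.
\<close>

definition colim_map ::
  "(int \<Rightarrow> ('r, 'v) module) \<Rightarrow> (int \<Rightarrow> 'v \<Rightarrow> 'v) \<Rightarrow> (int \<Rightarrow> 'u \<Rightarrow> 'v) \<Rightarrow>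
    (int \<times> 'u) set \<Rightarrow> (int \<times> 'v) set" where
  "colim_map N \<psi> h K = \<Union>{colim_in N \<psi> r (h r x) |r x. (r, x) \<in> K}"


section \<open>Bigraded exact couples\<close>

type_synonym bideg = "int \<times> int"

definition zscale :: "int \<Rightarrow> bideg \<Rightarrow> bideg" where
  "zscale m x = (m * fst x, m * snd x)"

text \<open>Determinant of the matrix with columns \<open>x\<close> and \<open>y\<close>.\<close>

definition det2 :: "bideg \<Rightarrow> bideg \<Rightarrow> int" where
  "det2 x y = fst x * snd y - snd x * fst y"

text \<open>
  All modules \<open>D\<^sub>x\<close> have their carriers in one type \<open>'d\<close>, and all modules \<open>E\<^sub>x\<close> in one type
  \<open>'e\<close>. This is no restriction, since these carriers need not be disjoint or exhaust the type.
\<close>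

record ('r, 'd, 'e) couple =
  Dmod :: "bideg \<Rightarrow> ('r, 'd) module"
  Emod :: "bideg \<Rightarrow> ('r, 'e) module"
  imap :: "bideg \<Rightarrow> 'd \<Rightarrow> 'd"
  jmap :: "bideg \<Rightarrow> 'd \<Rightarrow> 'e"
  kmap :: "bideg \<Rightarrow> 'e \<Rightarrow> 'd"

locale exact_couple = ring R
  for R :: "('r, 'q) ring_scheme" (structure)
    and a b c :: bideg and C :: "('r, 'd, 'e) couple" +
  assumes D_module: "left_module R (Dmod C x)"
    and E_module: "left_module R (Emod C x)"
    and i_linear: "imap C x \<in> lin_maps R (Dmod C x) (Dmod C (x + a))"
    and j_linear: "jmap C x \<in> lin_maps R (Dmod C x) (Emod C (x + b))"
    and k_linear: "kmap C x \<in> lin_maps R (Emod C x) (Dmod C (x + c))"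
    and exact_ij: "imap C (x - a) ` carrier (Dmod C (x - a))
        = a_kernel (Dmod C x) (Emod C (x + b)) (jmap C x)"
    and exact_jk: "jmap C x ` carrier (Dmod C x)
        = a_kernel (Emod C (x + b)) (Dmod C (x + b + c)) (kmap C (x + b))"
    and exact_ki: "kmap C (x + b) ` carrier (Emod C (x + b))
        = a_kernel (Dmod C (x + b + c)) (Dmod C (x + a + b + c)) (imap C (x + b + c))"

locale regular_exact_couple = exact_couple +
  assumes regular: "det2 a (b + c) \<in> {1, -1}"

definition couple_morphism ::
  "('r, 'q) ring_scheme \<Rightarrow> bideg \<Rightarrow> bideg \<Rightarrow> bideg \<Rightarrow>
    ('r, 'd1, 'e1) couple \<Rightarrow> ('r, 'd2, 'e2) couple \<Rightarrow>
    (bideg \<Rightarrow> 'd1 \<Rightarrow> 'd2) \<Rightarrow> (bideg \<Rightarrow> 'e1 \<Rightarrow> 'e2) \<Rightarrow> bool" where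
  "couple_morphism R a b c C1 C2 fD fE \<longleftrightarrow>
    (\<forall>x. fD x \<in> lin_maps R (Dmod C1 x) (Dmod C2 x)) \<and>
    (\<forall>x. fE x \<in> lin_maps R (Emod C1 x) (Emod C2 x)) \<and>
    (\<forall>x. \<forall>d\<in>carrier (Dmod C1 x). fD (x + a) (imap C1 x d) = imap C2 x (fD x d)) \<and>
    (\<forall>x. \<forall>d\<in>carrier (Dmod C1 x). fE (x + b) (jmap C1 x d) = jmap C2 x (fD x d)) \<and>
    (\<forall>x. \<forall>e\<in>carrier (Emod C1 x). fD (x + c) (kmap C1 x e) = kmap C2 x (fE x e))"


subsection \<open>The limit term\<close>

text \<open>The \<open>r\<close>-fold composite of \<open>i\<close> from \<open>D\<^sub>x\<close> to \<open>D\<close> at \<open>x + r a\<close>.\<close>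

definition ipow :: "bideg \<Rightarrow> ('r, 'd, 'e) couple \<Rightarrow> nat \<Rightarrow> bideg \<Rightarrow> 'd \<Rightarrow> 'd" where
  "ipow a C r x = iter_map (\<lambda>s. imap C (x + zscale s a)) r 0"

text \<open>
  The submodules of \<open>E\<^sub>y\<close> are indexed by \<open>y = x + b\<close>, where \<open>x\<close> is the bidegree of the source of
  \<open>j\<close>.
\<close>

definition Zsub :: "bideg \<Rightarrow> bideg \<Rightarrow> ('r, 'd, 'e) couple \<Rightarrow> nat \<Rightarrow> bideg \<Rightarrow> 'e set" where
  "Zsub a c C r y = {e \<in> carrier (Emod C y).
     kmap C y e \<in> ipow a C r (y + c - zscale (int r) a) `
       carrier (Dmod C (y + c - zscale (int r) a))}"

definition Bsub :: "bideg \<Rightarrow> bideg \<Rightarrow> ('r, 'd, 'e) couple \<Rightarrow> nat \<Rightarrow> bideg \<Rightarrow> 'e set" where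
  "Bsub a b C r y = jmap C (y - b) `
     a_kernel (Dmod C (y - b)) (Dmod C (y - b + zscale (int r) a)) (ipow a C r (y - b))"

definition E_infinity ::
  "bideg \<Rightarrow> bideg \<Rightarrow> bideg \<Rightarrow> ('r, 'd, 'e) couple \<Rightarrow> bideg \<Rightarrow> ('r, 'e set) module" where
  "E_infinity a b c C y =
    subquotient (Emod C y) (\<Inter>r. Zsub a c C r y) (\<Union>r. Bsub a b C r y)"

definition E_infinity_map ::
  "bideg \<Rightarrow> bideg \<Rightarrow> ('r, 'd2, 'e2) couple \<Rightarrow> (bideg \<Rightarrow> 'e1 \<Rightarrow> 'e2) \<Rightarrow>
    bideg \<Rightarrow> 'e1 set \<Rightarrow> 'e2 set" where
  "E_infinity_map a b C2 fE y = coset_map (Emod C2 y) (\<Union>r. Bsub a b C2 r y) (fE y)"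


subsection \<open>The colimit abutment and its filtration\<close>

text \<open>
  \<open>xpt a b c n r\<close> is \<open>x(n) + r a\<close> with \<open>x(n) = \<sigma> n (b + c)\<close>. For a regular couple these are,
  for varying \<open>r\<close>, exactly the bidegrees \<open>x\<close> with \<open>det2 a x = n\<close>.
\<close>

definition xpt :: "bideg \<Rightarrow> bideg \<Rightarrow> bideg \<Rightarrow> int \<Rightarrow> int \<Rightarrow> bideg" where
  "xpt a b c n r = zscale (det2 a (b + c) * n) (b + c) + zscale r a"

definition Ddiag ::
  "bideg \<Rightarrow> bideg \<Rightarrow> bideg \<Rightarrow> ('r, 'd, 'e) couple \<Rightarrow> int \<Rightarrow> int \<Rightarrow> ('r, 'd) module" where
  "Ddiag a b c C n r = Dmod C (xpt a b c n r)"

definition idiag ::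
  "bideg \<Rightarrow> bideg \<Rightarrow> bideg \<Rightarrow> ('r, 'd, 'e) couple \<Rightarrow> int \<Rightarrow> int \<Rightarrow> 'd \<Rightarrow> 'd" where
  "idiag a b c C n r = imap C (xpt a b c n r)"

definition abutment ::
  "bideg \<Rightarrow> bideg \<Rightarrow> bideg \<Rightarrow> ('r, 'd, 'e) couple \<Rightarrow> int \<Rightarrow> ('r, (int \<times> 'd) set) module" where
  "abutment a b c C n = colim (Ddiag a b c C n) (idiag a b c C n)"

definition abutment_map ::
  "bideg \<Rightarrow> bideg \<Rightarrow> bideg \<Rightarrow> ('r, 'd2, 'e2) couple \<Rightarrow> (bideg \<Rightarrow> 'd1 \<Rightarrow> 'd2) \<Rightarrow> int \<Rightarrow>
    (int \<times> 'd1) set \<Rightarrow> (int \<times> 'd2) set" where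
  "abutment_map a b c C2 fD n =
    colim_map (Ddiag a b c C2 n) (idiag a b c C2 n) (\<lambda>r. fD (xpt a b c n r))"

text \<open>\<open>filt a b c C n r\<close> is the filtration submodule of the abutment at \<open>x(n) + r a\<close>.\<close>

definition filt ::
  "bideg \<Rightarrow> bideg \<Rightarrow> bideg \<Rightarrow> ('r, 'd, 'e) couple \<Rightarrow> int \<Rightarrow> int \<Rightarrow> (int \<times> 'd) set set" where
  "filt a b c C n r =
    colim_in (Ddiag a b c C n) (idiag a b c C n) r ` carrier (Ddiag a b c C n r)"

text \<open>The limit of the filtration, that is its intersection, as a submodule of the abutment.\<close>

definition filt_lim ::
  "bideg \<Rightarrow> bideg \<Rightarrow> bideg \<Rightarrow> ('r, 'd, 'e) couple \<Rightarrow> int \<Rightarrow> ('r, (int \<times> 'd) set) module" where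
  "filt_lim a b c C n = (abutment a b c C n)\<lparr>carrier := \<Inter>r. filt a b c C n r\<rparr>"

end

theory Submission
  imports Defs
begin

text \<open>
  Let \<open>\<xi>\<close> be in the kernel of the map of abutments. The point is that \<open>\<xi>\<close> lies in every step
  of the filtration, so that the hypothesis on the intersection of the filtration kills it. Every
  element of the colimit lies in some step, so it is enough to move down by one step. If \<open>\<xi>\<close> is
  the class of \<open>d\<close> in \<open>D\<^sub>x\<close>, then the class of \<open>f d\<close> is zero, that is \<open>i\<^sup>k (f d) = 0\<close> for some
  \<open>k\<close>; hence \<open>j (f d)\<close> represents zero in \<open>E\<^sup>\<infinity>\<close> of the second couple. As \<open>f\<^sup>\<infinity>\<close> is injective
  and \<open>j d\<close> is a permanent cycle, \<open>j d = j d'\<close> for some \<open>d'\<close> that dies in the colimit. So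
  \<open>d - d'\<close>, which still represents \<open>\<xi>\<close>, is in the kernel of \<open>j\<close>, that is in the image of \<open>i\<close>,
  and \<open>\<xi>\<close> comes from \<open>D\<close> at \<open>x - a\<close> (\<open>mem_filt_pred\<close>, \<open>abutment_map_kernel_filt_pred\<close>).

  The colimits are handled through representatives: any two elements have representatives at a
  common index, and equality, sums, scalar multiples and induced maps can be read off there. In
  particular injectivity is tested on differences of representatives (\<open>colim_map_inj_onI\<close>).
\<close>

section \<open>Linear maps\<close>

lemma left_module_abelian_group: "left_module R M \<Longrightarrow> abelian_group M"
  by (simp add: left_module_def)

lemma lin_maps_abelian_group_hom:
  assumes "abelian_group M" "abelian_group N" "h \<in> lin_maps R M N"
  shows "abelian_group_hom M N h"
proof (rule abelian_group_homI[OF assms(1,2)])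
  show "group_hom (add_monoid M) (add_monoid N) h"
    using assms abelian_group.a_group[of M] abelian_group.a_group[of N]
    by (auto simp: group_hom_def group_hom_axioms_def hom_def lin_maps_def)
qed

lemma lin_maps_smult:
  "\<lbrakk>h \<in> lin_maps R M N; s \<in> carrier R; x \<in> carrier M\<rbrakk> \<Longrightarrow> h (s \<odot>\<^bsub>M\<^esub> x) = s \<odot>\<^bsub>N\<^esub> h x"
  by (simp add: lin_maps_def)

lemma lin_maps_comp:
  "\<lbrakk>g \<in> lin_maps R M N; h \<in> lin_maps R N P\<rbrakk> \<Longrightarrow> (\<lambda>x. h (g x)) \<in> lin_maps R M P"
  by (auto simp: lin_maps_def Pi_iff)

lemma lin_maps_id: "(\<lambda>x. x) \<in> lin_maps R M M"
  by (auto simp: lin_maps_def)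

section \<open>Directed colimits over the integers\<close>

lemma iter_map_add:
  "iter_map \<phi> (k + l) r x = iter_map \<phi> l (r + int k) (iter_map \<phi> k r x)"
  by (induction l) (simp_all add: algebra_simps)

lemma iter_map_shift: "iter_map (\<lambda>s. \<phi> (r + s)) k t x = iter_map \<phi> k (r + t) x"
  by (induction k) (simp_all add: algebra_simps)

locale direct_system =
  fixes R :: "('r, 'q) ring_scheme"
    and M :: "int \<Rightarrow> ('r, 'u) module" and \<phi> :: "int \<Rightarrow> 'u \<Rightarrow> 'u"
  assumes M_module: "left_module R (M r)"
    and \<phi>_linear: "\<phi> r \<in> lin_maps R (M r) (M (r + 1))"
begin

lemma M_abelian: "abelian_group (M r)"
  by (rule left_module_abelian_group[OF M_module])

lemma iter_linear: "iter_map \<phi> k r \<in> lin_maps R (M r) (M (r + int k))"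
proof (induction k)
  case 0
  then show ?case using lin_maps_id by (simp add: lin_maps_def)
next
  case (Suc k)
  then show ?case
    using lin_maps_comp[OF Suc \<phi>_linear[of "r + int k"]]
    by (simp add: algebra_simps lin_maps_def)
qed

lemma iter_hom: "abelian_group_hom (M r) (M (r + int k)) (iter_map \<phi> k r)"
  by (rule lin_maps_abelian_group_hom[OF M_abelian M_abelian iter_linear])

lemma zero_closed: "\<zero>\<^bsub>M r\<^esub> \<in> carrier (M r)"
  using M_abelian by (meson abelian_group_def abelian_monoid.zero_closed)

lemmas iter_closed = abelian_group_hom.hom_closed[OF iter_hom]
lemmas iter_plus = abelian_group_hom.hom_add[OF iter_hom, simplified]
lemmas iter_zero = abelian_group_hom.hom_zero[OF iter_hom]
lemmas iter_uminus = abelian_group_hom.hom_a_inv[OF iter_hom]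
lemmas iter_smult = lin_maps_smult[OF iter_linear]

lemma iter_eq_extend:
  assumes "r + int k = s + int l" "iter_map \<phi> k r x = iter_map \<phi> l s y"
  shows "iter_map \<phi> (k + m) r x = iter_map \<phi> (l + m) s y"
  using assms by (simp add: iter_map_add)

lemma colim_rel_iff:
  "((r, x), (s, y)) \<in> colim_rel M \<phi> \<longleftrightarrow> x \<in> carrier (M r) \<and> y \<in> carrier (M s) \<and>
     (\<exists>k l. r + int k = s + int l \<and> iter_map \<phi> k r x = iter_map \<phi> l s y)"
  by (simp add: colim_rel_def)

lemma colim_rel_equiv: "equiv (SIGMA r:UNIV. carrier (M r)) (colim_rel M \<phi>)"
proof (rule equivI)
  show "colim_rel M \<phi> \<subseteq> (SIGMA r:UNIV. carrier (M r)) \<times> (SIGMA r:UNIV. carrier (M r))"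
    by (auto simp: colim_rel_def)
  show "refl_on (SIGMA r:UNIV. carrier (M r)) (colim_rel M \<phi>)"
    by (auto simp: refl_on_def colim_rel_def)
  show "sym (colim_rel M \<phi>)"
  proof (rule symI)
    fix p q assume "(p, q) \<in> colim_rel M \<phi>"
    then show "(q, p) \<in> colim_rel M \<phi>"
      unfolding colim_rel_def by clarsimp metis
  qed
  show "trans (colim_rel M \<phi>)"
  proof (rule transI)
    fix p q u assume pq: "(p, q) \<in> colim_rel M \<phi>" and qu: "(q, u) \<in> colim_rel M \<phi>"
    obtain r x s y t z where e: "p = (r, x)" "q = (s, y)" "u = (t, z)"
      by (metis surj_pair)
    obtain k l where kl: "r + int k = s + int l" "iter_map \<phi> k r x = iter_map \<phi> l s y"
      using pq unfolding e colim_rel_iff by blast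
    obtain k' l' where kl': "s + int k' = t + int l'" "iter_map \<phi> k' s y = iter_map \<phi> l' t z"
      using qu unfolding e colim_rel_iff by blast
    have "iter_map \<phi> (k + k') r x = iter_map \<phi> (l' + l) t z"
      using iter_eq_extend[OF kl, of k'] iter_eq_extend[OF kl', of l] by (simp add: add.commute)
    moreover have "r + int (k + k') = t + int (l' + l)"
      using kl(1) kl'(1) by simp
    ultimately show "(p, u) \<in> colim_rel M \<phi>"
      using pq qu unfolding e colim_rel_iff by blast
  qed
qed

lemma colim_in_eq_iff:
  assumes "x \<in> carrier (M r)" "y \<in> carrier (M s)"
  shows "colim_in M \<phi> r x = colim_in M \<phi> s y \<longleftrightarrow>
    (\<exists>k l. r + int k = s + int l \<and> iter_map \<phi> k r x = iter_map \<phi> l s y)"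
  using eq_equiv_class_iff[OF colim_rel_equiv, of "(r, x)" "(s, y)"] assms
  by (simp add: colim_in_def colim_rel_iff)

lemma colim_in_eq_same_iff:
  assumes "x \<in> carrier (M r)" "y \<in> carrier (M r)"
  shows "colim_in M \<phi> r x = colim_in M \<phi> r y \<longleftrightarrow> (\<exists>k. iter_map \<phi> k r x = iter_map \<phi> k r y)"
  using colim_in_eq_iff[OF assms] by auto

lemma colim_in_iter:
  assumes "x \<in> carrier (M r)"
  shows "colim_in M \<phi> (r + int k) (iter_map \<phi> k r x) = colim_in M \<phi> r x"
proof -
  have "r + int k + int 0 = r + int k"
    "iter_map \<phi> 0 (r + int k) (iter_map \<phi> k r x) = iter_map \<phi> k r x" by simp_all
  then show ?thesis
    using colim_in_eq_iff[OF iter_closed[OF assms] assms] by blast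
qed

lemma colim_in_step:
  assumes "x \<in> carrier (M r)"
  shows "colim_in M \<phi> (r + 1) (\<phi> r x) = colim_in M \<phi> r x"
  using colim_in_iter[OF assms, of 1] by simp

lemma mem_colim_in_iff:
  assumes "x \<in> carrier (M r)"
  shows "(s, y) \<in> colim_in M \<phi> r x \<longleftrightarrow>
    y \<in> carrier (M s) \<and> colim_in M \<phi> s y = colim_in M \<phi> r x"
proof -
  have "(s, y) \<in> colim_in M \<phi> r x \<longleftrightarrow> ((r, x), (s, y)) \<in> colim_rel M \<phi>"
    by (simp add: colim_in_def)
  also have "\<dots> \<longleftrightarrow> y \<in> carrier (M s) \<and> colim_in M \<phi> r x = colim_in M \<phi> s y"
    using assms colim_in_eq_iff[OF assms] unfolding colim_rel_iff by blast
  finally show ?thesis by (simp only: eq_commute)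
qed

lemma colim_in_closed: "x \<in> carrier (M r) \<Longrightarrow> colim_in M \<phi> r x \<in> carrier (colim M \<phi>)"
  by (auto simp: colim_def colim_in_def intro!: quotientI)

lemma colim_cases:
  assumes "K \<in> carrier (colim M \<phi>)"
  obtains r x where "x \<in> carrier (M r)" "K = colim_in M \<phi> r x"
  using assms by (auto simp: colim_def colim_in_def elim!: quotientE)

lemma colim_in_raise:
  assumes "x \<in> carrier (M r)" "r \<le> s"
  obtains y where "y \<in> carrier (M s)" "colim_in M \<phi> s y = colim_in M \<phi> r x"
  using assms iter_closed[OF assms(1), of "nat (s - r)"] colim_in_iter[OF assms(1), of "nat (s - r)"]
  by auto

lemma colim_common_index:
  assumes "K \<in> carrier (colim M \<phi>)" "L \<in> carrier (colim M \<phi>)"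
  obtains r x y where "x \<in> carrier (M r)" "y \<in> carrier (M r)"
    "K = colim_in M \<phi> r x" "L = colim_in M \<phi> r y"
proof -
  obtain s u where su: "u \<in> carrier (M s)" "K = colim_in M \<phi> s u"
    using colim_cases[OF assms(1)] .
  obtain t v where tv: "v \<in> carrier (M t)" "L = colim_in M \<phi> t v"
    using colim_cases[OF assms(2)] .
  obtain x where "x \<in> carrier (M (max s t))" "colim_in M \<phi> (max s t) x = K"
    using colim_in_raise[OF su(1), of "max s t"] su(2) by auto
  moreover obtain y where "y \<in> carrier (M (max s t))" "colim_in M \<phi> (max s t) y = L"
    using colim_in_raise[OF tv(1), of "max s t"] tv(2) by auto
  ultimately show thesis using that by blast
qed

text \<open>
  The sum in \<^const>\<open>colim\<close> is a union over all pairs of representatives at a common index. By the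
  next lemma all of these give the same class, so that the union is that class.
\<close>

lemma colim_in_plus_cong:
  assumes xy: "x \<in> carrier (M r)" "y \<in> carrier (M r)"
    and uv: "u \<in> carrier (M s)" "v \<in> carrier (M s)"
    and eq: "colim_in M \<phi> s u = colim_in M \<phi> r x" "colim_in M \<phi> s v = colim_in M \<phi> r y"
  shows "colim_in M \<phi> s (u \<oplus>\<^bsub>M s\<^esub> v) = colim_in M \<phi> r (x \<oplus>\<^bsub>M r\<^esub> y)"
proof -
  interpret r: abelian_group "M r" by (rule M_abelian)
  interpret s: abelian_group "M s" by (rule M_abelian)
  obtain k l where kl: "s + int k = r + int l" "iter_map \<phi> k s u = iter_map \<phi> l r x"
    using eq(1) colim_in_eq_iff[OF uv(1) xy(1)] by auto
  obtain k' l' where kl': "s + int k' = r + int l'" "iter_map \<phi> k' s v = iter_map \<phi> l' r y"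
    using eq(2) colim_in_eq_iff[OF uv(2) xy(2)] by auto
  have ll: "l + k' = l' + k" using kl(1) kl'(1) by simp
  have ix: "s + int (k + k') = r + int (l + k')" using kl(1) by simp
  have u: "iter_map \<phi> (k + k') s u = iter_map \<phi> (l + k') r x"
    by (rule iter_eq_extend[OF kl])
  have v: "iter_map \<phi> (k + k') s v = iter_map \<phi> (l + k') r y"
    using iter_eq_extend[OF kl', of k] by (simp only: ll add.commute[of k k'])
  have "iter_map \<phi> (k + k') s (u \<oplus>\<^bsub>M s\<^esub> v) = iter_map \<phi> (l + k') r (x \<oplus>\<^bsub>M r\<^esub> y)"
    unfolding iter_plus[OF uv] iter_plus[OF xy] u v ix ..
  then show ?thesis
    using ix colim_in_eq_iff[of "u \<oplus>\<^bsub>M s\<^esub> v" s "x \<oplus>\<^bsub>M r\<^esub> y" r] uv xy by blast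
qed

lemma colim_in_smult_cong:
  assumes "s \<in> carrier R" and x: "x \<in> carrier (M r)" and u: "u \<in> carrier (M t)"
    and eq: "colim_in M \<phi> t u = colim_in M \<phi> r x"
  shows "colim_in M \<phi> t (s \<odot>\<^bsub>M t\<^esub> u) = colim_in M \<phi> r (s \<odot>\<^bsub>M r\<^esub> x)"
proof -
  obtain k l where kl: "t + int k = r + int l" "iter_map \<phi> k t u = iter_map \<phi> l r x"
    using eq colim_in_eq_iff[OF u x] by auto
  have "iter_map \<phi> k t (s \<odot>\<^bsub>M t\<^esub> u) = iter_map \<phi> l r (s \<odot>\<^bsub>M r\<^esub> x)"
    using iter_smult[OF assms(1) u, of k] iter_smult[OF assms(1) x, of l] kl by simp
  then show ?thesis
    using kl(1) assms(1) u x
      colim_in_eq_iff[of "s \<odot>\<^bsub>M t\<^esub> u" t "s \<odot>\<^bsub>M r\<^esub> x" r] left_module.smult_closed[OF M_module]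
    by blast
qed

lemma colim_add:
  assumes "x \<in> carrier (M r)" "y \<in> carrier (M r)"
  shows "colim_in M \<phi> r x \<oplus>\<^bsub>colim M \<phi>\<^esub> colim_in M \<phi> r y = colim_in M \<phi> r (x \<oplus>\<^bsub>M r\<^esub> y)"
proof -
  have "{colim_in M \<phi> s (u \<oplus>\<^bsub>M s\<^esub> v) |s u v.
      (s, u) \<in> colim_in M \<phi> r x \<and> (s, v) \<in> colim_in M \<phi> r y} = {colim_in M \<phi> r (x \<oplus>\<^bsub>M r\<^esub> y)}"
    unfolding mem_colim_in_iff[OF assms(1)] mem_colim_in_iff[OF assms(2)]
    using colim_in_plus_cong[OF assms] assms by blast
  then show ?thesis by (simp add: colim_def)
qed

lemma colim_smult:
  assumes "s \<in> carrier R" "x \<in> carrier (M r)"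
  shows "s \<odot>\<^bsub>colim M \<phi>\<^esub> colim_in M \<phi> r x = colim_in M \<phi> r (s \<odot>\<^bsub>M r\<^esub> x)"
proof -
  have "{colim_in M \<phi> t (s \<odot>\<^bsub>M t\<^esub> u) |t u. (t, u) \<in> colim_in M \<phi> r x}
      = {colim_in M \<phi> r (s \<odot>\<^bsub>M r\<^esub> x)}"
    unfolding mem_colim_in_iff[OF assms(2)] using colim_in_smult_cong[OF assms] assms by blast
  then show ?thesis by (simp add: colim_def)
qed

lemma colim_in_zero: "colim_in M \<phi> r \<zero>\<^bsub>M r\<^esub> = colim_in M \<phi> s \<zero>\<^bsub>M s\<^esub>"
proof -
  have ix: "r + int (nat (max r s - r)) = max r s" "s + int (nat (max r s - s)) = max r s"
    by simp_all
  show ?thesis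
    using colim_in_iter[OF zero_closed, of r "nat (max r s - r)"] colim_in_iter[OF zero_closed, of s "nat (max r s - s)"]
    by (simp only: iter_zero ix)
qed

lemma vanishing_iff:
  assumes "x \<in> carrier (M r)"
  shows "colim_in M \<phi> r x = colim_in M \<phi> r \<zero>\<^bsub>M r\<^esub> \<longleftrightarrow>
    (\<exists>k. iter_map \<phi> k r x = \<zero>\<^bsub>M (r + int k)\<^esub>)"
  using colim_in_eq_same_iff[OF assms zero_closed] by (simp add: iter_zero)

text \<open>
  The zero classes at the index \<open>r\<close> form a group; applied to \<open>D\<^sub>x\<close>, its image under \<open>j\<close> is the
  union of the boundaries that are divided out in \<open>E\<^sup>\<infinity>\<close>.
\<close>

lemma vanishing_subgroup:
  "subgroup {x \<in> carrier (M r). colim_in M \<phi> r x = colim_in M \<phi> r \<zero>\<^bsub>M r\<^esub>} (add_monoid (M r))"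
    (is "subgroup ?V _")
proof -
  interpret r: abelian_group "M r" by (rule M_abelian)
  have V: "x \<in> ?V \<longleftrightarrow> x \<in> carrier (M r) \<and> (\<exists>k. iter_map \<phi> k r x = \<zero>\<^bsub>M (r + int k)\<^esub>)" for x
    using vanishing_iff by blast
  show ?thesis
  proof (rule group.subgroupI[OF r.a_group])
    show "?V \<subseteq> carrier (add_monoid (M r))" by auto
    show "?V \<noteq> {}" using zero_closed by blast
  next
    fix x assume "x \<in> ?V"
    then obtain k where x: "x \<in> carrier (M r)" "iter_map \<phi> k r x = \<zero>\<^bsub>M (r + int k)\<^esub>"
      using V by blast
    interpret t: abelian_group "M (r + int k)" by (rule M_abelian)
    have "iter_map \<phi> k r (\<ominus>\<^bsub>M r\<^esub> x) = \<zero>\<^bsub>M (r + int k)\<^esub>"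
      using iter_uminus[OF x(1), of k] x(2) t.l_zero[OF t.a_inv_closed[OF t.zero_closed]]
        t.r_neg[OF t.zero_closed] by simp
    then have "\<ominus>\<^bsub>M r\<^esub> x \<in> ?V" using V x(1) by blast
    then show "inv\<^bsub>add_monoid (M r)\<^esub> x \<in> ?V" by (simp add: a_inv_def)
  next
    fix x y assume "x \<in> ?V" "y \<in> ?V"
    then have "colim_in M \<phi> r (x \<oplus>\<^bsub>M r\<^esub> y) = colim_in M \<phi> r (\<zero>\<^bsub>M r\<^esub> \<oplus>\<^bsub>M r\<^esub> \<zero>\<^bsub>M r\<^esub>)"
      using colim_in_plus_cong[OF zero_closed zero_closed] by blast
    then show "x \<otimes>\<^bsub>add_monoid (M r)\<^esub> y \<in> ?V" using \<open>x \<in> ?V\<close> \<open>y \<in> ?V\<close> by simp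
  qed
qed

end

locale direct_system_map = M: direct_system R M \<phi> + N: direct_system R N \<psi>
  for R :: "('r, 'q) ring_scheme" and M :: "int \<Rightarrow> ('r, 'u) module" and \<phi>
    and N :: "int \<Rightarrow> ('r, 'v) module" and \<psi> +
  fixes h :: "int \<Rightarrow> 'u \<Rightarrow> 'v"
  assumes h_linear: "h r \<in> lin_maps R (M r) (N r)"
    and h_step: "x \<in> carrier (M r) \<Longrightarrow> h (r + 1) (\<phi> r x) = \<psi> r (h r x)"
begin

lemma h_hom: "abelian_group_hom (M r) (N r) (h r)"
  by (rule lin_maps_abelian_group_hom[OF M.M_abelian N.M_abelian h_linear])

lemmas h_closed = abelian_group_hom.hom_closed[OF h_hom]
lemmas h_plus = abelian_group_hom.hom_add[OF h_hom, simplified]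
lemmas h_zero = abelian_group_hom.hom_zero[OF h_hom]
lemmas h_smult = lin_maps_smult[OF h_linear]

lemma h_iter:
  "x \<in> carrier (M r) \<Longrightarrow> h (r + int k) (iter_map \<phi> k r x) = iter_map \<psi> k r (h r x)"
proof (induction k)
  case (Suc k)
  then show ?case
    using h_step[OF M.iter_closed[OF Suc.prems, of k]] by (simp add: algebra_simps)
qed simp

lemma colim_in_h_cong:
  assumes x: "x \<in> carrier (M r)" and y: "y \<in> carrier (M s)"
    and eq: "colim_in M \<phi> s y = colim_in M \<phi> r x"
  shows "colim_in N \<psi> s (h s y) = colim_in N \<psi> r (h r x)"
proof -
  obtain k l where kl: "s + int k = r + int l" "iter_map \<phi> k s y = iter_map \<phi> l r x"
    using eq M.colim_in_eq_iff[OF y x] by auto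
  have "iter_map \<psi> k s (h s y) = iter_map \<psi> l r (h r x)"
    using h_iter[OF y, of k] h_iter[OF x, of l] kl by simp
  then show ?thesis
    using kl(1) N.colim_in_eq_iff[OF h_closed[OF y] h_closed[OF x]] by blast
qed

lemma colim_map_in:
  assumes "x \<in> carrier (M r)"
  shows "colim_map N \<psi> h (colim_in M \<phi> r x) = colim_in N \<psi> r (h r x)"
proof -
  have "{colim_in N \<psi> s (h s y) |s y. (s, y) \<in> colim_in M \<phi> r x} = {colim_in N \<psi> r (h r x)}"
    unfolding M.mem_colim_in_iff[OF assms] using colim_in_h_cong[OF assms] assms by blast
  then show ?thesis by (simp add: colim_map_def)
qed

lemma colim_map_linear: "colim_map N \<psi> h \<in> lin_maps R (colim M \<phi>) (colim N \<psi>)"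
  unfolding lin_maps_def
proof (intro CollectI conjI ballI Pi_I)
  fix K assume "K \<in> carrier (colim M \<phi>)"
  then obtain r x where K: "x \<in> carrier (M r)" "K = colim_in M \<phi> r x"
    by (rule M.colim_cases)
  show "colim_map N \<psi> h K \<in> carrier (colim N \<psi>)"
    using K by (simp add: colim_map_in h_closed N.colim_in_closed)
  fix s assume s: "s \<in> carrier R"
  have "s \<odot>\<^bsub>M r\<^esub> x \<in> carrier (M r)"
    by (rule left_module.smult_closed[OF M.M_module s K(1)])
  then show "colim_map N \<psi> h (s \<odot>\<^bsub>colim M \<phi>\<^esub> K) = s \<odot>\<^bsub>colim N \<psi>\<^esub> colim_map N \<psi> h K"
    using K s by (simp add: colim_map_in h_closed M.colim_smult N.colim_smult h_smult)
next
  fix K L assume "K \<in> carrier (colim M \<phi>)" "L \<in> carrier (colim M \<phi>)"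
  then obtain r x y where K: "x \<in> carrier (M r)" "y \<in> carrier (M r)"
    "K = colim_in M \<phi> r x" "L = colim_in M \<phi> r y"
    by (rule M.colim_common_index)
  have "x \<oplus>\<^bsub>M r\<^esub> y \<in> carrier (M r)"
    using K M.M_abelian by (meson abelian_group_def abelian_monoid.a_closed)
  then show "colim_map N \<psi> h (K \<oplus>\<^bsub>colim M \<phi>\<^esub> L)
      = colim_map N \<psi> h K \<oplus>\<^bsub>colim N \<psi>\<^esub> colim_map N \<psi> h L"
    using K by (simp add: colim_map_in h_closed M.colim_add N.colim_add h_plus)
qed

text \<open>
  Two classes are compared at a common index, where the difference of the representatives is
  available; this replaces the difference of the classes in the usual criterion for injectivity.
\<close>

lemma colim_map_inj_onI:
  assumes ker: "\<And>r d. \<lbrakk>d \<in> carrier (M r); colim_in N \<psi> r (h r d) = colim_in N \<psi> r \<zero>\<^bsub>N r\<^esub>\<rbrakk>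
      \<Longrightarrow> colim_in M \<phi> r d = colim_in M \<phi> r \<zero>\<^bsub>M r\<^esub>"
  shows "inj_on (colim_map N \<psi> h) (carrier (colim M \<phi>))"
proof (rule inj_onI)
  fix K L
  assume KL: "K \<in> carrier (colim M \<phi>)" "L \<in> carrier (colim M \<phi>)"
    and eq: "colim_map N \<psi> h K = colim_map N \<psi> h L"
  obtain r x y where x: "x \<in> carrier (M r)" and y: "y \<in> carrier (M r)"
    and K: "K = colim_in M \<phi> r x" and L: "L = colim_in M \<phi> r y"
    using KL by (rule M.colim_common_index)
  interpret r: abelian_group "M r" by (rule M.M_abelian)
  interpret s: abelian_group "N r" by (rule N.M_abelian)
  let ?d = "x \<oplus>\<^bsub>M r\<^esub> (\<ominus>\<^bsub>M r\<^esub> y)"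
  have d: "?d \<in> carrier (M r)" using x y by simp
  have "colim_in N \<psi> r (h r x) = colim_in N \<psi> r (h r y)"
    using eq by (simp add: K L colim_map_in x y)
  then have "colim_in N \<psi> r (h r x \<oplus>\<^bsub>N r\<^esub> h r (\<ominus>\<^bsub>M r\<^esub> y))
      = colim_in N \<psi> r (h r y \<oplus>\<^bsub>N r\<^esub> h r (\<ominus>\<^bsub>M r\<^esub> y))"
    using x y by (intro N.colim_in_plus_cong) (auto intro: h_closed)
  then have "colim_in N \<psi> r (h r ?d) = colim_in N \<psi> r (h r \<zero>\<^bsub>M r\<^esub>)"
    using x y by (simp add: h_plus[symmetric] r.r_neg)
  then have "colim_in M \<phi> r ?d = colim_in M \<phi> r \<zero>\<^bsub>M r\<^esub>"
    using ker[OF d] by (simp add: h_zero)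
  then have "colim_in M \<phi> r (?d \<oplus>\<^bsub>M r\<^esub> y) = colim_in M \<phi> r (\<zero>\<^bsub>M r\<^esub> \<oplus>\<^bsub>M r\<^esub> y)"
    using d y by (intro M.colim_in_plus_cong) auto
  then show "K = L"
    using x y by (simp add: K L r.a_assoc r.l_neg)
qed

end

section \<open>The filtration of the abutment\<close>

lemma xpt_succ: "xpt a b c n (r + 1) = xpt a b c n r + a"
  by (simp add: xpt_def zscale_def prod_eq_iff algebra_simps)

lemma xpt_add: "xpt a b c n (r + s) = xpt a b c n r + zscale s a"
  by (simp add: xpt_def zscale_def prod_eq_iff algebra_simps)

context exact_couple
begin

lemma D_abelian: "abelian_group (Dmod C x)" and E_abelian: "abelian_group (Emod C x)"
  by (rule left_module_abelian_group[OF D_module], rule left_module_abelian_group[OF E_module])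

text \<open>
  An arbitrary base point is needed: the abutment uses the line through \<open>x(n)\<close>, but the iterates
  of \<open>i\<close> in the definition of \<open>Z\<^sup>r\<close> run along the parallel line through \<open>x + b + c\<close>.
\<close>

lemma line_direct_system:
  "direct_system R (\<lambda>s. Dmod C (x + zscale s a)) (\<lambda>s. imap C (x + zscale s a))"
proof (rule direct_system.intro)
  show "left_module R (Dmod C (x + zscale s a))" for s by (rule D_module)
  have "x + zscale (s + 1) a = x + zscale s a + a" for s
    by (simp add: zscale_def prod_eq_iff algebra_simps)
  then show "imap C (x + zscale s a)
      \<in> lin_maps R (Dmod C (x + zscale s a)) (Dmod C (x + zscale (s + 1) a))" for s
    using i_linear[of "x + zscale s a"] by (simp only:)
qed

lemma diag_direct_system: "direct_system R (Ddiag a b c C n) (idiag a b c C n)"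
  using line_direct_system[of "zscale (det2 a (b + c) * n) (b + c)"]
  unfolding Ddiag_def[abs_def] idiag_def[abs_def] xpt_def .

lemma j_hom: "abelian_group_hom (Dmod C x) (Emod C (x + b)) (jmap C x)"
  by (rule lin_maps_abelian_group_hom[OF D_abelian E_abelian j_linear])

text \<open>As \<open>k \<circ> j = 0\<close>, the elements of the image of \<open>j\<close> are permanent cycles.\<close>

lemma j_mem_Z:
  assumes d: "d \<in> carrier (Dmod C x)"
  shows "jmap C x d \<in> Zsub a c C k (x + b)"
proof -
  define y where "y = x + b + c - zscale (int k) a"
  have y: "y + zscale (int k) a = x + b + c" "y + zscale 0 a = y"
    by (simp_all add: y_def zscale_def prod_eq_iff)
  interpret direct_system R "\<lambda>s. Dmod C (y + zscale s a)" "\<lambda>s. imap C (y + zscale s a)"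
    by (rule line_direct_system)
  have "ipow a C k y \<zero>\<^bsub>Dmod C y\<^esub> = \<zero>\<^bsub>Dmod C (x + b + c)\<^esub>"
    using iter_zero[of k 0] y by (simp add: ipow_def)
  moreover have "kmap C (x + b) (jmap C x d) = \<zero>\<^bsub>Dmod C (x + b + c)\<^esub>"
    using exact_jk[of x] d by (auto simp: a_kernel_def')
  moreover have "\<zero>\<^bsub>Dmod C y\<^esub> \<in> carrier (Dmod C y)"
    by (meson D_abelian abelian_group_def abelian_monoid.zero_closed)
  ultimately have "kmap C (x + b) (jmap C x d) \<in> ipow a C k y ` carrier (Dmod C y)"
    by (metis imageI)
  then show ?thesis
    using abelian_group_hom.hom_closed[OF j_hom d] by (simp add: Zsub_def y_def)
qed

lemma Union_B:
  "(\<Union>k. Bsub a b C k (xpt a b c n r + b)) = jmap C (xpt a b c n r) `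
    {d \<in> carrier (Ddiag a b c C n r). colim_in (Ddiag a b c C n) (idiag a b c C n) r d
      = colim_in (Ddiag a b c C n) (idiag a b c C n) r \<zero>\<^bsub>Ddiag a b c C n r\<^esub>}"
proof -
  interpret direct_system R "Ddiag a b c C n" "idiag a b c C n" by (rule diag_direct_system)
  have p: "ipow a C k (xpt a b c n r) = iter_map (idiag a b c C n) k r" for k
    using iter_map_shift[of "idiag a b c C n" r k 0]
    by (auto simp: ipow_def idiag_def[abs_def] xpt_add)
  have B: "Bsub a b C k (xpt a b c n r + b) = jmap C (xpt a b c n r) `
      {d \<in> carrier (Ddiag a b c C n r).
        iter_map (idiag a b c C n) k r d = \<zero>\<^bsub>Ddiag a b c C n (r + int k)\<^esub>}" for k
    by (simp add: Bsub_def p a_kernel_def' Ddiag_def xpt_add)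
  have "(\<Union>k. {d \<in> carrier (Ddiag a b c C n r).
        iter_map (idiag a b c C n) k r d = \<zero>\<^bsub>Ddiag a b c C n (r + int k)\<^esub>})
      = {d \<in> carrier (Ddiag a b c C n r). colim_in (Ddiag a b c C n) (idiag a b c C n) r d
        = colim_in (Ddiag a b c C n) (idiag a b c C n) r \<zero>\<^bsub>Ddiag a b c C n r\<^esub>}"
    unfolding set_eq_iff[of "\<Union>k. _ k"] by (simp add: vanishing_iff cong: conj_cong)
  then show ?thesis
    unfolding B image_UN[symmetric] by (rule arg_cong)
qed

lemma Union_B_subgroup:
  "additive_subgroup (\<Union>k. Bsub a b C k (xpt a b c n r + b)) (Emod C (xpt a b c n r + b))"
proof -
  interpret direct_system R "Ddiag a b c C n" "idiag a b c C n" by (rule diag_direct_system)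
  interpret j: abelian_group_hom "Dmod C (xpt a b c n r)" "Emod C (xpt a b c n r + b)"
    "jmap C (xpt a b c n r)" by (rule j_hom)
  show ?thesis
    unfolding Union_B
    by (rule additive_subgroupI)
      (use group_hom.subgroup_img_is_subgroup[OF j.a_group_hom] vanishing_subgroup[of r] in
        \<open>simp add: Ddiag_def\<close>)
qed

lemma filt_mono_step: "filt a b c C n r \<subseteq> filt a b c C n (r + 1)"
proof -
  interpret direct_system R "Ddiag a b c C n" "idiag a b c C n" by (rule diag_direct_system)
  have "idiag a b c C n r d \<in> carrier (Ddiag a b c C n (r + 1))"
    if "d \<in> carrier (Ddiag a b c C n r)" for d
    using iter_closed[OF that, of 1] by simp
  then show ?thesis
    unfolding filt_def using colim_in_step[symmetric] by blast
qed

text \<open>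
  The element \<open>d\<close> may be changed by some \<open>d'\<close> that dies in the colimit so that \<open>j\<close> kills it;
  then it comes from the previous step by exactness at \<open>D\<close>.
\<close>

lemma mem_filt_pred:
  assumes d: "d \<in> carrier (Ddiag a b c C n r)"
    and jd: "jmap C (xpt a b c n r) d \<in> (\<Union>k. Bsub a b C k (xpt a b c n r + b))"
  shows "colim_in (Ddiag a b c C n) (idiag a b c C n) r d \<in> filt a b c C n (r - 1)"
proof -
  interpret direct_system R "Ddiag a b c C n" "idiag a b c C n" by (rule diag_direct_system)
  let ?x = "xpt a b c n r" and ?M = "Ddiag a b c C n r"
  interpret D: abelian_group ?M by (rule M_abelian)
  interpret j: abelian_group_hom ?M "Emod C (?x + b)" "jmap C ?x"
    unfolding Ddiag_def by (rule j_hom)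
  let ?in = "colim_in (Ddiag a b c C n) (idiag a b c C n)"
  obtain d' where d': "d' \<in> carrier ?M" "?in r d' = ?in r \<zero>\<^bsub>?M\<^esub>" "jmap C ?x d = jmap C ?x d'"
    using jd unfolding Union_B by auto
  have m: "\<ominus>\<^bsub>?M\<^esub> d' \<in> carrier ?M" "?in r (\<ominus>\<^bsub>?M\<^esub> d') = ?in r \<zero>\<^bsub>?M\<^esub>"
    using subgroup.m_inv_closed[OF vanishing_subgroup[of r], of d'] d' by (simp_all add: a_inv_def)
  let ?u = "d \<oplus>\<^bsub>?M\<^esub> (\<ominus>\<^bsub>?M\<^esub> d')"
  have u: "?u \<in> carrier ?M" using d d' by simp
  have "?in r ?u = ?in r (d \<oplus>\<^bsub>?M\<^esub> \<zero>\<^bsub>?M\<^esub>)"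
    by (rule colim_in_plus_cong[OF d D.zero_closed d m(1) refl m(2)])
  then have in_u: "?in r ?u = ?in r d" using d by simp
  have "jmap C ?x ?u = \<zero>\<^bsub>Emod C (?x + b)\<^esub>"
    using d d' j.hom_closed[OF d'(1)] by (simp add: j.H.r_neg)
  then have "?u \<in> a_kernel (Dmod C ?x) (Emod C (?x + b)) (jmap C ?x)"
    using u unfolding a_kernel_def' Ddiag_def by blast
  moreover have "xpt a b c n (r - 1) = ?x - a"
    using xpt_succ[of a b c n "r - 1"] by simp
  ultimately have "?u \<in> idiag a b c C n (r - 1) ` carrier (Ddiag a b c C n (r - 1))"
    unfolding exact_ij[symmetric] idiag_def Ddiag_def by (simp only:)
  then obtain w where w: "w \<in> carrier (Ddiag a b c C n (r - 1))" "?u = idiag a b c C n (r - 1) w"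
    by auto
  have "?in r d = ?in (r - 1) w"
    using in_u colim_in_step[OF w(1)] w(2) by simp
  then show ?thesis
    using w(1) by (simp add: filt_def)
qed

end

lemma (in regular_exact_couple) det2_xpt: "det2 a (xpt a b c n r) = n"
proof -
  have "det2 a (xpt a b c n r) = det2 a (b + c) * det2 a (b + c) * n"
    by (simp add: det2_def xpt_def zscale_def algebra_simps)
  also have "\<dots> = n" using regular by auto
  finally show ?thesis .
qed

section \<open>The kernel of the map of abutments\<close>

lemma (in abelian_group) a_r_coset_eq_self_iff:
  assumes "additive_subgroup B G" "e \<in> carrier G"
  shows "B +> e = B \<longleftrightarrow> e \<in> B"
  using a_coset_join1[of B e] a_coset_join2[of e B] additive_subgroup.a_subgroup[OF assms(1)]
    assms(2) by blast

lemma coset_map_eq_zero: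
  fixes M :: "('r, 'u) module" and N :: "('r, 'v) module"
  assumes M: "abelian_group M" and N: "abelian_group N" and h: "h \<in> lin_maps R M N"
    and B: "additive_subgroup B M" and B': "additive_subgroup B' N"
    and hB: "h ` B \<subseteq> B'" and e: "e \<in> carrier M" "h e \<in> B'"
  shows "coset_map N B' h (B +>\<^bsub>M\<^esub> e) = B'"
proof -
  interpret M: abelian_group M by fact
  interpret N: abelian_group N by fact
  interpret h: abelian_group_hom M N h by (rule lin_maps_abelian_group_hom[OF M N h])
  interpret B: additive_subgroup B M by fact
  interpret B': additive_subgroup B' N by fact
  have "B' +>\<^bsub>N\<^esub> h (u \<oplus>\<^bsub>M\<^esub> e) = B'" if "u \<in> B" for u
  proof -
    have "h (u \<oplus>\<^bsub>M\<^esub> e) \<in> B'"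
      using that hB e B.a_Hcarr[OF that] B'.a_closed by auto
    then show ?thesis
      using N.a_r_coset_eq_self_iff[OF B'] B'.a_Hcarr by blast
  qed
  then have "(\<Union>u\<in>B. B' +>\<^bsub>N\<^esub> h (u \<oplus>\<^bsub>M\<^esub> e)) = (\<Union>u\<in>B. B')" by simp
  moreover have "B +>\<^bsub>M\<^esub> e = (\<lambda>u. u \<oplus>\<^bsub>M\<^esub> e) ` B" by (auto simp: a_r_coset_def')
  moreover have "B \<noteq> {}" using B.zero_closed by blast
  ultimately show ?thesis
    unfolding coset_map_def by simp
qed

lemma couple_morphismD:
  assumes "couple_morphism R a b c C1 C2 fD fE"
  shows "fD x \<in> lin_maps R (Dmod C1 x) (Dmod C2 x)"
    and "fE x \<in> lin_maps R (Emod C1 x) (Emod C2 x)"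
    and "d \<in> carrier (Dmod C1 x) \<Longrightarrow> fD (x + a) (imap C1 x d) = imap C2 x (fD x d)"
    and "d \<in> carrier (Dmod C1 x) \<Longrightarrow> fE (x + b) (jmap C1 x d) = jmap C2 x (fD x d)"
  using assms unfolding couple_morphism_def by blast+

lemma abutment_direct_system_map:
  assumes "exact_couple R a b c C1" "exact_couple R a b c C2"
    and f: "couple_morphism R a b c C1 C2 fD fE"
  shows "direct_system_map R (Ddiag a b c C1 n) (idiag a b c C1 n)
    (Ddiag a b c C2 n) (idiag a b c C2 n) (\<lambda>r. fD (xpt a b c n r))"
  using exact_couple.diag_direct_system[OF assms(1)] exact_couple.diag_direct_system[OF assms(2)]
    couple_morphismD(1,3)[OF f]
  by (simp add: direct_system_map_def direct_system_map_axioms_def Ddiag_def idiag_def xpt_succ)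

text \<open>
  Since \<open>f d\<close> dies in the colimit, \<open>j (f d)\<close> is a boundary, so \<open>j d\<close> and zero have the same
  image in \<open>E\<^sup>\<infinity>\<close> of the second couple. By injectivity \<open>j d\<close> is a boundary already in the first
  couple.
\<close>

lemma abutment_map_kernel_filt_pred:
  assumes C1: "exact_couple R a b c C1" and C2: "exact_couple R a b c C2"
    and f: "couple_morphism R a b c C1 C2 fD fE"
    and inj: "inj_on (E_infinity_map a b C2 fE (xpt a b c n r + b))
      (carrier (E_infinity a b c C1 (xpt a b c n r + b)))"
    and d: "d \<in> carrier (Ddiag a b c C1 n r)"
    and fd: "colim_in (Ddiag a b c C2 n) (idiag a b c C2 n) r (fD (xpt a b c n r) d)
      = colim_in (Ddiag a b c C2 n) (idiag a b c C2 n) r \<zero>\<^bsub>Ddiag a b c C2 n r\<^esub>"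
  shows "colim_in (Ddiag a b c C1 n) (idiag a b c C1 n) r d \<in> filt a b c C1 n (r - 1)"
proof -
  interpret C1: exact_couple R a b c C1 by fact
  interpret C2: exact_couple R a b c C2 by fact
  interpret direct_system_map R "Ddiag a b c C1 n" "idiag a b c C1 n"
    "Ddiag a b c C2 n" "idiag a b c C2 n" "\<lambda>r. fD (xpt a b c n r)"
    by (rule abutment_direct_system_map[OF C1 C2 f])
  let ?x = "xpt a b c n r"
  interpret D: abelian_group "Ddiag a b c C1 n r" by (rule M.M_abelian)
  interpret E: abelian_group "Emod C1 (?x + b)" by (rule C1.E_abelian)
  interpret j: abelian_group_hom "Ddiag a b c C1 n r" "Emod C1 (?x + b)" "jmap C1 ?x"
    unfolding Ddiag_def by (rule C1.j_hom)
  let ?B1 = "\<Union>k. Bsub a b C1 k (?x + b)" and ?B2 = "\<Union>k. Bsub a b C2 k (?x + b)"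
  interpret B1: additive_subgroup ?B1 "Emod C1 (?x + b)" by (rule C1.Union_B_subgroup)
  have fE: "fE (?x + b) \<in> lin_maps R (Emod C1 (?x + b)) (Emod C2 (?x + b))"
    by (rule couple_morphismD(2)[OF f])
  have fj: "fE (?x + b) (jmap C1 ?x u) = jmap C2 ?x (fD ?x u)"
    if "u \<in> carrier (Ddiag a b c C1 n r)" for u
    using couple_morphismD(4)[OF f] that by (simp add: Ddiag_def)
  have fB: "fE (?x + b) ` ?B1 \<subseteq> ?B2"
  proof
    fix v assume "v \<in> fE (?x + b) ` ?B1"
    then obtain u where u: "u \<in> carrier (Ddiag a b c C1 n r)" "v = jmap C2 ?x (fD ?x u)"
      "colim_in (Ddiag a b c C1 n) (idiag a b c C1 n) r u
        = colim_in (Ddiag a b c C1 n) (idiag a b c C1 n) r \<zero>\<^bsub>Ddiag a b c C1 n r\<^esub>"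
      unfolding C1.Union_B using fj by auto
    then show "v \<in> ?B2"
      unfolding C2.Union_B using colim_in_h_cong[OF D.zero_closed u(1) u(3)] h_closed[OF u(1)]
      by (auto simp: h_zero)
  qed
  have fjd: "fE (?x + b) (jmap C1 ?x d) \<in> ?B2"
    unfolding C2.Union_B fj[OF d] using fd h_closed[OF d] by auto
  have zero_B2: "fE (?x + b) \<zero>\<^bsub>Emod C1 (?x + b)\<^esub> \<in> ?B2"
    using fB B1.zero_closed by blast
  have "coset_map (Emod C2 (?x + b)) ?B2 (fE (?x + b)) (?B1 +>\<^bsub>Emod C1 (?x + b)\<^esub> e) = ?B2"
    if "e \<in> carrier (Emod C1 (?x + b))" "fE (?x + b) e \<in> ?B2" for e
    by (rule coset_map_eq_zero[OF C1.E_abelian C2.E_abelian fE C1.Union_B_subgroup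
          C2.Union_B_subgroup fB that])
  then have eq: "E_infinity_map a b C2 fE (?x + b) (?B1 +>\<^bsub>Emod C1 (?x + b)\<^esub> jmap C1 ?x d)
      = E_infinity_map a b C2 fE (?x + b) (?B1 +>\<^bsub>Emod C1 (?x + b)\<^esub> \<zero>\<^bsub>Emod C1 (?x + b)\<^esub>)"
    using fjd zero_B2 j.hom_closed[OF d] unfolding E_infinity_map_def by blast
  have Z: "?B1 +>\<^bsub>Emod C1 (?x + b)\<^esub> jmap C1 ?x u
      \<in> carrier (E_infinity a b c C1 (?x + b))" if "u \<in> carrier (Ddiag a b c C1 n r)" for u
    using C1.j_mem_Z[of u ?x] that by (auto simp: E_infinity_def subquotient_def Ddiag_def)
  \<comment> \<open>Both cosets lie in \<open>E\<^sup>\<infinity>\<close>, as zero is also in the image of \<open>j\<close>.\<close>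
  have "?B1 +>\<^bsub>Emod C1 (?x + b)\<^esub> jmap C1 ?x d = ?B1 +>\<^bsub>Emod C1 (?x + b)\<^esub> \<zero>\<^bsub>Emod C1 (?x + b)\<^esub>"
    using inj_onD[OF inj eq] Z[OF d] Z[OF D.zero_closed] j.hom_zero by simp
  then have "jmap C1 ?x d \<in> ?B1"
    using E.a_r_coset_eq_self_iff[OF C1.Union_B_subgroup] j.hom_closed[OF d]
      E.a_coset_add_zero[OF B1.a_subset] by metis
  then show ?thesis by (rule C1.mem_filt_pred[OF d])
qed

theorem lemma2p5p1:
  fixes R :: "('r, 'q) ring_scheme"
    and a b c :: "int \<times> int"
    and C1 :: "('r, 'd1, 'e1) couple"
    and C2 :: "('r, 'd2, 'e2) couple"
    and fD :: "int \<times> int \<Rightarrow> 'd1 \<Rightarrow> 'd2"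
    and fE :: "int \<times> int \<Rightarrow> 'e1 \<Rightarrow> 'e2"
    and n :: int
  assumes C1: "regular_exact_couple R a b c C1"
    and C2: "regular_exact_couple R a b c C2"
    and f: "couple_morphism R a b c C1 C2 fD fE"
    and E_infinity_mono: "\<And>x. det2 a x = n \<Longrightarrow>
      monomorphism R (E_infinity a b c C1 (x + b)) (E_infinity a b c C2 (x + b))
        (E_infinity_map a b C2 fE (x + b))"
    and filt_lim_mono:
      "monomorphism R (filt_lim a b c C1 n) (filt_lim a b c C2 n) (abutment_map a b c C2 fD n)"
  shows "monomorphism R (abutment a b c C1 n) (abutment a b c C2 n) (abutment_map a b c C2 fD n)"
proof -
  interpret C1: regular_exact_couple R a b c C1 by fact
  interpret C2: regular_exact_couple R a b c C2 by fact
  interpret direct_system_map R "Ddiag a b c C1 n" "idiag a b c C1 n"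
    "Ddiag a b c C2 n" "idiag a b c C2 n" "\<lambda>r. fD (xpt a b c n r)"
    by (rule abutment_direct_system_map[OF C1.exact_couple_axioms C2.exact_couple_axioms f])
  let ?in1 = "colim_in (Ddiag a b c C1 n) (idiag a b c C1 n)"
  let ?in2 = "colim_in (Ddiag a b c C2 n) (idiag a b c C2 n)"
  let ?zero = "\<lambda>r. \<zero>\<^bsub>Ddiag a b c C1 n r\<^esub>"
  have "?in1 r d = ?in1 r (?zero r)"
    if d: "d \<in> carrier (Ddiag a b c C1 n r)"
      and fd: "?in2 r (fD (xpt a b c n r) d) = ?in2 r \<zero>\<^bsub>Ddiag a b c C2 n r\<^esub>" for r d
  proof -
    have down: "?in1 r d \<in> filt a b c C1 n (s - 1)" if s: "?in1 r d \<in> filt a b c C1 n s" for s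
    proof -
      obtain e where e: "e \<in> carrier (Ddiag a b c C1 n s)" "?in1 r d = ?in1 s e"
        using s by (auto simp: filt_def)
      have "?in2 s (fD (xpt a b c n s) e) = ?in2 s \<zero>\<^bsub>Ddiag a b c C2 n s\<^esub>"
        using colim_in_h_cong[OF d e(1)] e(2) fd N.colim_in_zero[of r s] by simp
      moreover have "inj_on (E_infinity_map a b C2 fE (xpt a b c n s + b))
          (carrier (E_infinity a b c C1 (xpt a b c n s + b)))"
        using E_infinity_mono[OF C1.det2_xpt] by (simp add: monomorphism_def)
      ultimately show ?thesis
        using abutment_map_kernel_filt_pred[OF C1.exact_couple_axioms C2.exact_couple_axioms f
            _ e(1)] e(2) by simp
    qed
    \<comment> \<open>The class lies in the step \<open>r\<close>, in the later ones because the filtration increases, and in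
      the earlier ones because it is in the kernel.\<close>
    have "?in1 r d \<in> filt a b c C1 n s" for s
    proof (induction s rule: int_induct[where k = r])
      case base
      then show ?case using d by (simp add: filt_def)
    qed (use C1.filt_mono_step down in blast)+
    moreover have "?in1 r (?zero r) \<in> filt a b c C1 n s" for s
      using M.zero_closed[of s] M.colim_in_zero[of r s] by (simp add: filt_def)
    moreover have "abutment_map a b c C2 fD n (?in1 r d)
        = abutment_map a b c C2 fD n (?in1 r (?zero r))"
      using fd by (simp add: abutment_map_def colim_map_in d M.zero_closed h_zero)
    ultimately show ?thesis
      using filt_lim_mono by (auto simp: monomorphism_def filt_lim_def dest: inj_onD)
  qed
  then show ?thesis
    unfolding monomorphism_def abutment_def abutment_map_def
    using colim_map_linear colim_map_inj_onI by blast
qed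

end
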